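(* Let $G$ be a digraph, $R$ a commutative ring with unit, $n\ge0$, $v\in V_G$ and $x_1,\dots,x_m\in\Omega_n(G;R)$. If $F_G^n(x_1,\dots,x_m)$ is an upper face multihypergraph and the upper extension of $x_1+\cdots+x_m$ by $v$ is an upper extension over $F_G^n(x_1,\dots,x_m)$ which is $v$-complete, then \[[x_1+\cdots+x_m]^v\in\Omega_{n+1}(G;R).\] Similarly, if $F_G^n(x_1,\dots,x_m)$ is a lower face multihypergraph and the lower extension of $x_1+\cdots+x_m$ by $v$ is a lower extension over $F_G^n(x_1,\dots,x_m)$ which is $v$-complete, then \[[x_1+\cdots+x_m]_v\in\Omega_{n+1}(G;R).\]
   Context: **Path chains.** A digraph $G=(V_G,E_G)$ is a set $V_G$ (possibly infinite) with $E_G\subseteq\{(u,v)\in V_G\times V_G: u\neq v\}$. For $n\ge 0$, an (allowed) $n$-path is a sequence of vertices, written $e_{v_0,\dots,v_n}$, with $(v_{i-1},v_i)\in E_G$ for $i=1,\dots,n$; $P^G_n$ is the set of allowed $n$-paths. Let $\mathcal{R}_n$ be the free $R$-module on all sequences $e_{v_0,\dots,v_n}$ in $V_G$ modulo the span of those with $v_{i-1}=v_i$ for some $i$, with differential $\partial^P_n(e_{v_0,\dots,v_n})=\sum_{i=0}^n(-1)^i e_{v_0,\dots,\hat v_i,\dots,v_n}$ (and $\mathcal{R}_n=0$ for $n<0$). Let $\mathcal{A}_n(G;R)\subseteq\mathcal{R}_n$ be the free submodule spanned by the allowed $n$-paths, and $\Omega_n(G;R)=\{x\in\mathcal{A}_n(G;R):\partial^P_n(x)\in\mathcal{A}_{n-1}(G;R)\}$,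 with $\Omega_n(G;R)=0$ for $n<0$. **Heads, tails, face maps.** Write $x=\sum_{e_{v_0,\dots,v_n}\in P^G_n}\alpha_{v_0,\dots,v_n}e_{v_0,\dots,v_n}$. The head set $\bar h(x)$ (tail set $\bar t(x)$) is the set of last vertices $v_n$ (first vertices $v_0$) of the paths with nonzero coefficient in $x$. For $v\in V_G$, $\delta^h_{n,v}(x)=\sum_{v_{n-1}=v}\alpha_{v_0,\dots,v_n}e_{v_0,\dots,v_{n-1}}$ and $\delta^t_{n,v}(x)=\sum_{v_1=v}\alpha_{v_0,\dots,v_n}e_{v_1,\dots,v_n}$ (both zero for $n=0$); these map $\Omega_n(G;R)$ to $\Omega_{n-1}(G;R)$. Set $\delta^h_n=\sum_v\delta^h_{n,v}$, $\delta^t_n=\sum_v\delta^t_{n,v}$. **Face multihypergraphs.** Let $x_1,\dots,x_m\in\Omega_n(G;R)$ ($m\ge1$, repetitions allowed) with $x_i\ne -x_j$ for $i\neq j$. An upper face multihypergraph $F^n_G(x_1,\dots,x_m)$ consists of: (a) for each $i$ and each $u\in V_G$ with $\delta^h_{n,u}(x_i)\ne0$, a chosen finite list $x_i^{u,1},\dots,x_i^{u,m_i^u}\in\Omega_{n-1}(G;R)$ with $\delta^h_{n,u}(x_i)=x_i^{u,1}+\dots+x_i^{u,m_i^u}$, no nonempty sublist of which sums to zero; (b) a labeled multihypergraph with $m$ vertices $1,\dots,m$, vertex $i$ labeled $x_i$, each of whose hyperedges is labeled by a pair $(\{x_{i_1}^{u,k_1},\dots,x_{i_t}^{u,k_t}\},u)$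 with $u\in V_G$, $t\ge2$, where the terms are among those chosen in (a) (regarded as formally distinct symbols indexed by the pairs $(i_j,k_j)$) and the hyperedge joins the vertices $i_1,\dots,i_t$, such that either $t=2$, $i_1\ne i_2$ and $x_{i_1}^{u,k_1}=-x_{i_2}^{u,k_2}$, or $t\ge3$, $i_1,\dots,i_t$ are not all equal, $x_{i_1}^{u,k_1}=\dots=x_{i_t}^{u,k_t}$ and $x_{i_1}^{u,k_1}+\dots+x_{i_t}^{u,k_t}=0$; (c) each chosen term $x_i^{u,k}$ appears in at most one hyperedge label. Lower face multihypergraphs are defined identically with $\delta^t$ in place of $\delta^h$. **Extensions.** For $v\in V_G$ and $x\in\Omega_n(G;R)$, the upper and lower extensions of $x$ by $v$ are $[x]^v=\sum_{e_{v_0,\dots,v_n,v}\in P^G_{n+1}}\alpha_{v_0,\dots,v_n}e_{v_0,\dots,v_n,v}$ and $[x]_v=\sum_{e_{v,v_0,\dots,v_n}\in P^G_{n+1}}\alpha_{v_0,\dots,v_n}e_{v,v_0,\dots,v_n}$, in $\mathcal{A}_{n+1}(G;R)$. For an upper (lower) face multihypergraph $F=F^n_G(x_1,\dots,x_m)$, the element $[x_1+\dots+x_m]^v$ ($[x_1+\dots+x_m]_v$) is an upper (lower) extension by $v$ over $F$ if $(w,v)\in E_G$ for all $w\in\bar h(x_i)$ ($(v,w)\in E_G$ for all $w\in\bar t(x_i)$) and all $i$. It is $v$-proper if every hyperedge label $(\{\dots\},u)$ satisfies $(u,v)\notin E_G$ ($(v,u)\notin E_G$) and $u\ne v$. It is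 $v$-complete if it is $v$-proper and, for every $i$ and every $u\in\bar h(\delta^h_n(x_i))\setminus\{v\}$ with $(u,v)\notin E_G$ ($u\in\bar t(\delta^t_n(x_i))\setminus\{v\}$ with $(v,u)\notin E_G$), each term $x_i^{u,k}$, $k=1,\dots,m_i^u$, appears in some hyperedge label. *)

theory Defs
  imports "HOL-Library.Poly_Mapping" "HOL-Library.Sublist" "Graph_Theory.Pair_Digraph"
begin

text \<open>
  Digraphs are \<^locale>\<open>pair_loopfree_digraph\<close>s: arcs are pairs of distinct vertices and the vertex
  set may be infinite. The coefficient ring has sort \<open>{comm_ring, monoid_mult}\<close>, i.e. it is a
  commutative ring with unit; \<^class>\<open>comm_ring_1\<close> would in addition exclude the zero ring.

  A sequence \<open>v\<^sub>0, \<dots>, v\<^sub>n\<close> is a list of length \<open>n + 1\<close>, so that \<open>p ! i\<close> is \<open>v\<^sub>i\<close>. A free module on a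
  set \<open>B\<close> of sequences is the set of finitely supported functions whose support lies in \<open>B\<close>.
\<close>

type_synonym ('v, 'r) chain = "'v list \<Rightarrow>\<^sub>0 'r"

section \<open>Path chains\<close>

definition sequences :: "'v pair_pre_digraph \<Rightarrow> nat \<Rightarrow> 'v list set" where
  "sequences G n = {p. length p = n + 1 \<and> set p \<subseteq> pverts G}"

definition allowed_paths :: "'v pair_pre_digraph \<Rightarrow> nat \<Rightarrow> 'v list set" where
  "allowed_paths G n = {p \<in> sequences G n. \<forall>i\<in>{1..n}. (p ! (i - 1), p ! i) \<in> parcs G}"

definition degenerate_chains :: "'v pair_pre_digraph \<Rightarrow> nat \<Rightarrow> ('v, 'r::zero) chain set" where
  "degenerate_chains G n =
     {x. Poly_Mapping.keys x \<subseteq> {p \<in> sequences G n. \<exists>i\<in>{1..n}. p ! (i - 1) = p ! i}}"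

text \<open>
  Equality in the quotient \<open>\<R>\<^sub>n\<close> of the free module on all sequences of length \<open>n + 1\<close> by the
  degenerate ones.
\<close>
definition regular_eq ::
    "'v pair_pre_digraph \<Rightarrow> nat \<Rightarrow> ('v, 'r::ab_group_add) chain \<Rightarrow> ('v, 'r) chain \<Rightarrow> bool" where
  "regular_eq G n x y \<longleftrightarrow> x - y \<in> degenerate_chains G n"

text \<open>
  The differential on representatives. In degree 0 it vanishes, since \<open>\<R>\<^sub>n = 0\<close> for \<open>n < 0\<close>.
\<close>
definition path_boundary ::
    "nat \<Rightarrow> ('v, 'r::{comm_ring, monoid_mult}) chain \<Rightarrow> ('v, 'r) chain" where
  "path_boundary n x =
     (if n = 0 then 0
      else \<Sum>p\<in>Poly_Mapping.keys x. \<Sum>i\<le>n.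
             Poly_Mapping.single (take i p @ drop (Suc i) p) ((- 1) ^ i * Poly_Mapping.lookup x p))"

text \<open>
  Allowed paths are not degenerate, so the span of the allowed paths embeds into \<open>\<R>\<^sub>n\<close>; its elements
  are represented by the unique representative supported on allowed paths.
\<close>
definition allowed_chains :: "'v pair_pre_digraph \<Rightarrow> nat \<Rightarrow> ('v, 'r::zero) chain set" where
  "allowed_chains G n = {x. Poly_Mapping.keys x \<subseteq> allowed_paths G n}"

text \<open>
  The condition on the boundary says that its class in \<open>\<R>\<^sub>n\<^sub>-\<^sub>1\<close> lies in the image of the allowed
  chains. For \<open>n = 0\<close> the boundary is 0 and the condition holds with \<open>y = 0\<close>.
\<close>
definition invariant_chains ::
    "'v pair_pre_digraph \<Rightarrow> nat \<Rightarrow> ('v, 'r::{comm_ring, monoid_mult}) chain set" where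
  "invariant_chains G n =
     {x \<in> allowed_chains G n.
        \<exists>y\<in>allowed_chains G (n - 1). regular_eq G (n - 1) (path_boundary n x) y}"

section \<open>Heads, tails and face maps\<close>

definition head_set :: "('v, 'r::zero) chain \<Rightarrow> 'v set" where
  "head_set x = last ` Poly_Mapping.keys x"

definition tail_set :: "('v, 'r::zero) chain \<Rightarrow> 'v set" where
  "tail_set x = hd ` Poly_Mapping.keys x"

definition head_face_at :: "nat \<Rightarrow> 'v \<Rightarrow> ('v, 'r::comm_monoid_add) chain \<Rightarrow> ('v, 'r) chain" where
  "head_face_at n v x =
     (if n = 0 then 0
      else \<Sum>p | p \<in> Poly_Mapping.keys x \<and> p ! (n - 1) = v.
             Poly_Mapping.single (butlast p) (Poly_Mapping.lookup x p))"

definition tail_face_at :: "nat \<Rightarrow> 'v \<Rightarrow> ('v, 'r::comm_monoid_add) chain \<Rightarrow> ('v, 'r) chain" where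
  "tail_face_at n v x =
     (if n = 0 then 0
      else \<Sum>p | p \<in> Poly_Mapping.keys x \<and> p ! 1 = v.
             Poly_Mapping.single (tl p) (Poly_Mapping.lookup x p))"

text \<open>Only finitely many vertices contribute to the sum over all vertices.\<close>
definition head_face ::
    "'v pair_pre_digraph \<Rightarrow> nat \<Rightarrow> ('v, 'r::comm_monoid_add) chain \<Rightarrow> ('v, 'r) chain" where
  "head_face G n x = (\<Sum>v | v \<in> pverts G \<and> head_face_at n v x \<noteq> 0. head_face_at n v x)"

definition tail_face ::
    "'v pair_pre_digraph \<Rightarrow> nat \<Rightarrow> ('v, 'r::comm_monoid_add) chain \<Rightarrow> ('v, 'r) chain" where
  "tail_face G n x = (\<Sum>v | v \<in> pverts G \<and> tail_face_at n v x \<noteq> 0. tail_face_at n v x)"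

section \<open>Face multihypergraphs\<close>

text \<open>
  The elements \<open>x\<^sub>1, \<dots>, x\<^sub>m\<close> form a list \<open>xs\<close>; indices start at 0. For \<open>F = F\<^sub>G\<^sup>n(x\<^sub>1, \<dots>, x\<^sub>m)\<close>,
  \<open>face_terms F i u\<close> is the chosen list of summands of the face of \<open>x\<^sub>i\<close> at \<open>u\<close>; it is only used for
  those \<open>i\<close>, \<open>u\<close> for which that face is nonzero.

  A hyperedge is its label \<open>(S, u)\<close>, where \<open>(i, k) \<in> S\<close> is the formal symbol of the term
  \<open>face_terms F i u ! k\<close>; it joins the vertices \<open>i\<close> with \<open>(i, k) \<in> S\<close>, a vertex being repeated if
  several of its terms occur. Different hyperedges may join the same vertices, but they never share
  a label, as a term occurs in at most one hyperedge.
\<close>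
record (overloaded) ('v, 'r) face_multihypergraph =
  face_terms :: "nat \<Rightarrow> 'v \<Rightarrow> ('v, 'r) chain list"
  hyperedges :: "((nat \<times> nat) set \<times> 'v) set"

text \<open>The symbols of all terms chosen at the vertex \<open>u\<close>, for the face maps \<open>d\<close>.\<close>
definition term_symbols ::
    "('v \<Rightarrow> ('v, 'r::zero) chain \<Rightarrow> ('v, 'r) chain) \<Rightarrow> ('v, 'r) chain list \<Rightarrow>
     ('v, 'r) face_multihypergraph \<Rightarrow> 'v \<Rightarrow> (nat \<times> nat) set" where
  "term_symbols d xs F u =
     {(i, k). i < length xs \<and> d u (xs ! i) \<noteq> 0 \<and> k < length (face_terms F i u)}"

text \<open>
  That no nonempty sublist sums to zero refers to arbitrary, not necessarily contiguous, sublists.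
\<close>
definition face_decomposition ::
    "'v pair_pre_digraph \<Rightarrow> nat \<Rightarrow>
     ('v \<Rightarrow> ('v, 'r::{comm_ring, monoid_mult}) chain \<Rightarrow> ('v, 'r) chain) \<Rightarrow>
     ('v, 'r) chain list \<Rightarrow> ('v, 'r) face_multihypergraph \<Rightarrow> bool" where
  "face_decomposition G n d xs F \<longleftrightarrow>
     (\<forall>i<length xs. \<forall>u\<in>pverts G. d u (xs ! i) \<noteq> 0 \<longrightarrow>
        set (face_terms F i u) \<subseteq> invariant_chains G (n - 1) \<and>
        d u (xs ! i) = sum_list (face_terms F i u) \<and>
        (\<forall>ys. subseq ys (face_terms F i u) \<and> ys \<noteq> [] \<longrightarrow> sum_list ys \<noteq> 0))"

text \<open>
  The first alternative is a hyperedge joining \<open>t = 2\<close> vertices, the second one has \<open>t = card S\<close>.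
\<close>
definition admissible_label ::
    "'v pair_pre_digraph \<Rightarrow>
     ('v \<Rightarrow> ('v, 'r::ab_group_add) chain \<Rightarrow> ('v, 'r) chain) \<Rightarrow>
     ('v, 'r) chain list \<Rightarrow> ('v, 'r) face_multihypergraph \<Rightarrow> (nat \<times> nat) set \<Rightarrow> 'v \<Rightarrow> bool" where
  "admissible_label G d xs F S u \<longleftrightarrow>
     u \<in> pverts G \<and> S \<subseteq> term_symbols d xs F u \<and>
     ((\<exists>i k j l. S = {(i, k), (j, l)} \<and> i \<noteq> j \<and> face_terms F i u ! k = - face_terms F j u ! l) \<or>
      (card S \<ge> 3 \<and>
       (\<exists>(i, k)\<in>S. \<exists>(j, l)\<in>S. i \<noteq> j) \<and>
       (\<forall>(i, k)\<in>S. \<forall>(j, l)\<in>S. face_terms F i u ! k = face_terms F j u ! l) \<and>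
       (\<Sum>(i, k)\<in>S. face_terms F i u ! k) = 0))"

definition face_multihypergraph ::
    "'v pair_pre_digraph \<Rightarrow> nat \<Rightarrow>
     ('v \<Rightarrow> ('v, 'r::{comm_ring, monoid_mult}) chain \<Rightarrow> ('v, 'r) chain) \<Rightarrow>
     ('v, 'r) chain list \<Rightarrow> ('v, 'r) face_multihypergraph \<Rightarrow> bool" where
  "face_multihypergraph G n d xs F \<longleftrightarrow>
     xs \<noteq> [] \<and> set xs \<subseteq> invariant_chains G n \<and>
     (\<forall>i<length xs. \<forall>j<length xs. i \<noteq> j \<longrightarrow> xs ! i \<noteq> - xs ! j) \<and>
     face_decomposition G n d xs F \<and>
     (\<forall>(S, u)\<in>hyperedges F. admissible_label G d xs F S u) \<and>
     (\<forall>S T u. (S, u) \<in> hyperedges F \<and> (T, u) \<in> hyperedges F \<and> S \<inter> T \<noteq> {} \<longrightarrow> S = T)"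

definition upper_face_multihypergraph ::
    "'v pair_pre_digraph \<Rightarrow> nat \<Rightarrow> ('v, 'r::{comm_ring, monoid_mult}) chain list \<Rightarrow>
     ('v, 'r) face_multihypergraph \<Rightarrow> bool" where
  "upper_face_multihypergraph G n xs F \<longleftrightarrow> face_multihypergraph G n (head_face_at n) xs F"

definition lower_face_multihypergraph ::
    "'v pair_pre_digraph \<Rightarrow> nat \<Rightarrow> ('v, 'r::{comm_ring, monoid_mult}) chain list \<Rightarrow>
     ('v, 'r) face_multihypergraph \<Rightarrow> bool" where
  "lower_face_multihypergraph G n xs F \<longleftrightarrow> face_multihypergraph G n (tail_face_at n) xs F"

section \<open>Extensions\<close>

definition upper_extension ::
    "'v pair_pre_digraph \<Rightarrow> nat \<Rightarrow> 'v \<Rightarrow> ('v, 'r::comm_monoid_add) chain \<Rightarrow> ('v, 'r) chain" where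
  "upper_extension G n v x =
     (\<Sum>p | p \<in> Poly_Mapping.keys x \<and> p @ [v] \<in> allowed_paths G (n + 1).
        Poly_Mapping.single (p @ [v]) (Poly_Mapping.lookup x p))"

definition lower_extension ::
    "'v pair_pre_digraph \<Rightarrow> nat \<Rightarrow> 'v \<Rightarrow> ('v, 'r::comm_monoid_add) chain \<Rightarrow> ('v, 'r) chain" where
  "lower_extension G n v x =
     (\<Sum>p | p \<in> Poly_Mapping.keys x \<and> v # p \<in> allowed_paths G (n + 1).
        Poly_Mapping.single (v # p) (Poly_Mapping.lookup x p))"

text \<open>
  Being an extension by \<open>v\<close> over \<open>F\<^sub>G\<^sup>n(x\<^sub>1, \<dots>, x\<^sub>m)\<close> only depends on the vertex labels \<open>x\<^sub>1, \<dots>, x\<^sub>m\<close>.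
\<close>
definition is_upper_extension_over ::
    "'v pair_pre_digraph \<Rightarrow> 'v \<Rightarrow> ('v, 'r::zero) chain list \<Rightarrow> bool" where
  "is_upper_extension_over G v xs \<longleftrightarrow> (\<forall>x\<in>set xs. \<forall>w\<in>head_set x. (w, v) \<in> parcs G)"

definition is_lower_extension_over ::
    "'v pair_pre_digraph \<Rightarrow> 'v \<Rightarrow> ('v, 'r::zero) chain list \<Rightarrow> bool" where
  "is_lower_extension_over G v xs \<longleftrightarrow> (\<forall>x\<in>set xs. \<forall>w\<in>tail_set x. (v, w) \<in> parcs G)"

definition upper_proper ::
    "'v pair_pre_digraph \<Rightarrow> 'v \<Rightarrow> ('v, 'r::zero) face_multihypergraph \<Rightarrow> bool" where
  "upper_proper G v F \<longleftrightarrow> (\<forall>(S, u)\<in>hyperedges F. (u, v) \<notin> parcs G \<and> u \<noteq> v)"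

definition lower_proper ::
    "'v pair_pre_digraph \<Rightarrow> 'v \<Rightarrow> ('v, 'r::zero) face_multihypergraph \<Rightarrow> bool" where
  "lower_proper G v F \<longleftrightarrow> (\<forall>(S, u)\<in>hyperedges F. (v, u) \<notin> parcs G \<and> u \<noteq> v)"

definition upper_complete ::
    "'v pair_pre_digraph \<Rightarrow> nat \<Rightarrow> 'v \<Rightarrow> ('v, 'r::comm_monoid_add) chain list \<Rightarrow>
     ('v, 'r) face_multihypergraph \<Rightarrow> bool" where
  "upper_complete G n v xs F \<longleftrightarrow>
     upper_proper G v F \<and>
     (\<forall>i<length xs. \<forall>u\<in>head_set (head_face G n (xs ! i)) - {v}. (u, v) \<notin> parcs G \<longrightarrow>
        (\<forall>k<length (face_terms F i u). \<exists>S. (S, u) \<in> hyperedges F \<and> (i, k) \<in> S))"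

definition lower_complete ::
    "'v pair_pre_digraph \<Rightarrow> nat \<Rightarrow> 'v \<Rightarrow> ('v, 'r::comm_monoid_add) chain list \<Rightarrow>
     ('v, 'r) face_multihypergraph \<Rightarrow> bool" where
  "lower_complete G n v xs F \<longleftrightarrow>
     lower_proper G v F \<and>
     (\<forall>i<length xs. \<forall>u\<in>tail_set (tail_face G n (xs ! i)) - {v}. (v, u) \<notin> parcs G \<longrightarrow>
        (\<forall>k<length (face_terms F i u). \<exists>S. (S, u) \<in> hyperedges F \<and> (i, k) \<in> S))"

end

theory Submission
  imports Defs
begin

text \<open>
  Appending \<open>v\<close> to all paths of \<open>x = x\<^sub>1 + \<dots> + x\<^sub>m\<close> gives \<open>\<partial>[x]\<^sup>v = [\<partial>x]\<^sup>v \<plusminus> x\<close>, so the only possibly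
  bad terms come from paths \<open>q\<close> of \<open>\<partial>x\<close> whose last vertex \<open>u \<noteq> v\<close> has no arc to \<open>v\<close>. No path of \<open>x\<close>
  ends in such a \<open>u\<close>, so \<open>q\<close> arises only by deleting last vertices, and its coefficient is up to sign
  that of \<open>q\<close> in the face of \<open>x\<close> at \<open>u\<close>. This face vanishes: by completeness its chosen terms are
  partitioned by the hyperedges at \<open>u\<close>, each of which sums to zero.
\<close>

section \<open>Invariant chains by their supports\<close>

abbreviation face :: "nat \<Rightarrow> 'v list \<Rightarrow> 'v list" where
  "face i p \<equiv> take i p @ drop (Suc i) p"

text \<open>The spanning set behind \<open>degenerate_chains\<close>, named so that equality in the
  quotient can be read off supports.\<close>

definition degenerate_paths :: "'v pair_pre_digraph \<Rightarrow> nat \<Rightarrow> 'v list set" where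
  "degenerate_paths G n = {p \<in> sequences G n. \<exists>i\<in>{1..n}. p ! (i - 1) = p ! i}"

lemma allowed_pathsD:
  assumes "p \<in> allowed_paths G n"
  shows "length p = Suc n" "p \<noteq> []" "set p \<subseteq> pverts G"
  using assms by (auto simp: allowed_paths_def sequences_def)

text \<open>Allowed and degenerate paths are both sets of basis sequences, so the quotient condition
  is visible on supports: a boundary is an allowed chain plus a degenerate one exactly when each of
  its paths is of one kind or the other. This removes the existential quantifier from all later
  arguments.\<close>

lemma invariant_chains_iff:
  "x \<in> invariant_chains G n \<longleftrightarrow>
     Poly_Mapping.keys x \<subseteq> allowed_paths G n \<and>
     Poly_Mapping.keys (path_boundary n x) \<subseteq> allowed_paths G (n - 1) \<union> degenerate_paths G (n - 1)"
  (is "?l \<longleftrightarrow> ?a \<and> ?b")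
proof
  assume ?l
  then obtain y where x: ?a and y: "Poly_Mapping.keys y \<subseteq> allowed_paths G (n - 1)"
    and d: "Poly_Mapping.keys (path_boundary n x - y) \<subseteq> degenerate_paths G (n - 1)"
    by (auto simp: invariant_chains_def allowed_chains_def regular_eq_def degenerate_chains_def
        degenerate_paths_def)
  have "Poly_Mapping.keys (path_boundary n x)
      \<subseteq> Poly_Mapping.keys y \<union> Poly_Mapping.keys (path_boundary n x - y)"
    using keys_add[of y "path_boundary n x - y"] by simp
  with x y d show "?a \<and> ?b" by blast
next
  assume ab: "?a \<and> ?b"
  let ?z = "path_boundary n x" and ?A = "allowed_paths G (n - 1)"
  \<comment> \<open>The witness is the restriction of the boundary to allowed paths; what remains
    can only be degenerate.\<close>
  define y where "y = (\<Sum>p\<in>Poly_Mapping.keys ?z \<inter> ?A. Poly_Mapping.single p (Poly_Mapping.lookup ?z p))"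
  have l: "Poly_Mapping.lookup y q = (if q \<in> ?A then Poly_Mapping.lookup ?z q else 0)" for q
    by (auto simp: y_def lookup_sum lookup_single when_def sum.delta in_keys_iff)
  have "Poly_Mapping.keys y \<subseteq> ?A" by (auto simp: in_keys_iff l split: if_splits)
  moreover have "Poly_Mapping.keys (?z - y) \<subseteq> degenerate_paths G (n - 1)"
    using ab by (auto simp: in_keys_iff l lookup_minus split: if_splits)
  ultimately show ?l using ab
    by (auto simp: invariant_chains_def allowed_chains_def regular_eq_def degenerate_chains_def
        degenerate_paths_def)
qed

text \<open>Cancellation can make the support of \<open>x + y\<close> smaller than the union of the
  two supports. Since \<open>f p 0 = 0\<close>, all three sums extend to that union, where
  additivity applies termwise. Additivity of the boundary, of \<open>push_chain\<close> and of the
  face maps all come from here.\<close>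

lemma sum_keys_add:
  fixes x y :: "'a \<Rightarrow>\<^sub>0 'b::comm_monoid_add"
  assumes zero: "\<And>p. f p 0 = 0" and add: "\<And>p a b. f p (a + b) = f p a + f p b"
  shows "(\<Sum>p\<in>Poly_Mapping.keys (x + y). f p (Poly_Mapping.lookup (x + y) p)) =
    (\<Sum>p\<in>Poly_Mapping.keys x. f p (Poly_Mapping.lookup x p)) +
    (\<Sum>p\<in>Poly_Mapping.keys y. f p (Poly_Mapping.lookup y p))"
proof -
  let ?K = "Poly_Mapping.keys x \<union> Poly_Mapping.keys y"
  have "(\<Sum>p\<in>Poly_Mapping.keys z. f p (Poly_Mapping.lookup z p)) =
      (\<Sum>p\<in>?K. f p (Poly_Mapping.lookup z p))"
    if "Poly_Mapping.keys z \<subseteq> ?K" for z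
    using that by (intro sum.mono_neutral_left) (auto simp: in_keys_iff zero)
  from this[of "x + y"] this[of x] this[of y] keys_add[of x y] show ?thesis
    by (simp only: lookup_add add sum.distrib) simp
qed

lemma path_boundary_add: "path_boundary n (x + y) = path_boundary n x + path_boundary n y"
  unfolding path_boundary_def
  by (auto intro!: sum_keys_add simp: single_add distrib_left sum.distrib)

lemma invariant_chains_add:
  assumes "x \<in> invariant_chains G n" "y \<in> invariant_chains G n"
  shows "x + y \<in> invariant_chains G n"
  using assms keys_add[of x y] keys_add[of "path_boundary n x" "path_boundary n y"]
  unfolding invariant_chains_iff path_boundary_add by blast

lemma invariant_chains_sum_list:
  "set xs \<subseteq> invariant_chains G n \<Longrightarrow> sum_list xs \<in> invariant_chains G n"
proof (induction xs)
  case Nil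
  show ?case by (simp add: invariant_chains_iff path_boundary_def)
qed (simp add: invariant_chains_add)

lemma keys_sum_list:
  "Poly_Mapping.keys (sum_list xs) \<subseteq> (\<Union>x\<in>set xs. Poly_Mapping.keys x)"
proof (induction xs)
  case (Cons a xs)
  then show ?case using keys_add[of a "sum_list xs"] by auto
qed simp

section \<open>Pushing chains forward along extensions of paths\<close>

text \<open>With \<open>f\<close> appending or prepending \<open>v\<close>, this is an extension
  without the filter for allowed results. It can thus also be applied to a boundary, whose extended
  paths may be degenerate.\<close>

definition push_chain :: "('v list \<Rightarrow> 'v list) \<Rightarrow> ('v, 'r::comm_monoid_add) chain \<Rightarrow> ('v, 'r) chain" where
  "push_chain f x = (\<Sum>p\<in>Poly_Mapping.keys x. Poly_Mapping.single (f p) (Poly_Mapping.lookup x p))"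

lemma push_chain_add: "push_chain f (x + y) = push_chain f x + push_chain f y"
  unfolding push_chain_def by (auto intro!: sum_keys_add simp: single_add)

lemma push_chain_zero [simp]: "push_chain f 0 = 0"
  by (simp add: push_chain_def)

lemma push_chain_single [simp]:
  "push_chain f (Poly_Mapping.single p a) = Poly_Mapping.single (f p) a"
  by (simp add: push_chain_def)

lemma push_chain_sum: "push_chain f (sum g A) = (\<Sum>a\<in>A. push_chain f (g a))"
  by (induction A rule: infinite_finite_induct) (auto simp: push_chain_add)

lemma keys_push_chain: "Poly_Mapping.keys (push_chain f x) \<subseteq> f ` Poly_Mapping.keys x"
  unfolding push_chain_def
  by (rule order_trans[OF keys_sum]) auto

section \<open>The boundary of an extended chain\<close>

lemma path_boundary_sum:
  "path_boundary n (sum g A) = (\<Sum>a\<in>A. path_boundary n (g a))"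
  by (induction A rule: infinite_finite_induct)
    (auto simp: path_boundary_add, auto simp: path_boundary_def)

lemma path_boundary_single:
  "n \<noteq> 0 \<Longrightarrow> path_boundary n (Poly_Mapping.single p a) =
     (\<Sum>i\<le>n. Poly_Mapping.single (face i p) ((- 1) ^ i * a))"
  by (simp add: path_boundary_def)

text \<open>Deleting one of the vertices \<open>0..n\<close> of \<open>p @ [v]\<close> commutes with
  appending \<open>v\<close>; deleting the last one returns \<open>p\<close> with sign
  \<open>(- 1) ^ Suc n\<close>. The length hypothesis places \<open>v\<close> at index
  \<open>Suc n\<close>. Degree 0 is excluded because there \<open>path_boundary\<close> is 0 by
  convention instead of producing the empty path.\<close>

lemma path_boundary_push_append:
  fixes x :: "('v, 'r::{comm_ring, monoid_mult}) chain"
  assumes len: "\<And>p. p \<in> Poly_Mapping.keys x \<Longrightarrow> length p = Suc n" and "n \<noteq> 0"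
  shows "path_boundary (Suc n) (push_chain (\<lambda>p. p @ [v]) x) = push_chain (\<lambda>p. p @ [v]) (path_boundary n x)
     + (\<Sum>p\<in>Poly_Mapping.keys x. Poly_Mapping.single p ((- 1) ^ Suc n * Poly_Mapping.lookup x p))"
proof -
  have "path_boundary (Suc n) (Poly_Mapping.single (p @ [v]) a) =
      (\<Sum>i\<le>n. Poly_Mapping.single (face i p @ [v]) ((- 1) ^ i * a))
      + Poly_Mapping.single p ((- 1) ^ Suc n * a)"
    if "length p = Suc n" for p and a :: 'r
    using that by (auto simp: path_boundary_single intro!: sum.cong)
  with len \<open>n \<noteq> 0\<close> show ?thesis
    by (simp add: push_chain_def[of _ x] path_boundary_sum path_boundary_def[of n x] push_chain_sum
        sum.distrib)
qed

text \<open>Prepending shifts every index by one, which flips all signs, and deletion at index 0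
  returns \<open>x\<close>. The new vertex sits at index 0 for every length.\<close>

lemma path_boundary_push_Cons:
  fixes x :: "('v, 'r::{comm_ring, monoid_mult}) chain"
  assumes "n \<noteq> 0"
  shows "path_boundary (Suc n) (push_chain ((#) v) x) = x - push_chain ((#) v) (path_boundary n x)"
proof -
  have "path_boundary (Suc n) (Poly_Mapping.single (v # p) a) =
      Poly_Mapping.single p a - (\<Sum>i\<le>n. Poly_Mapping.single (v # face i p) ((- 1) ^ i * a))"
    for p and a :: 'r
    by (simp add: path_boundary_single sum.atMost_Suc_shift single_uminus sum_negf mult.assoc
        del: sum.atMost_Suc)
  moreover have "(\<Sum>p\<in>Poly_Mapping.keys x. Poly_Mapping.single p (Poly_Mapping.lookup x p)) = x"
    by (rule poly_mapping_eqI)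
      (auto simp: lookup_sum lookup_single when_def sum.delta in_keys_iff)
  ultimately show ?thesis using \<open>n \<noteq> 0\<close>
    by (simp add: push_chain_def[of _ x] path_boundary_sum path_boundary_def[of n x] push_chain_sum
        sum_subtractf)
qed

lemma path_boundary_1_single:
  "path_boundary (Suc 0) (Poly_Mapping.single [v, w] a) =
     Poly_Mapping.single [w] a - Poly_Mapping.single [v] a"
  by (simp add: path_boundary_single single_uminus)

text \<open>Serves the extension of 0-chains, where the two preceding formulas fail: an extended
  path has two vertices, and its faces are these vertices.\<close>

lemma keys_boundary_1:
  assumes "\<And>p. p \<in> Poly_Mapping.keys x \<Longrightarrow> \<exists>a b. f p = [a, b] \<and> {[a], [b]} \<subseteq> A"
  shows "Poly_Mapping.keys (path_boundary (Suc 0) (push_chain f x)) \<subseteq> A"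
  unfolding push_chain_def path_boundary_sum
proof (rule order_trans[OF keys_sum], rule UN_least)
  fix p assume "p \<in> Poly_Mapping.keys x"
  then obtain a b where f: "f p = [a, b]" and A: "{[a], [b]} \<subseteq> A" using assms by blast
  show "Poly_Mapping.keys (path_boundary (Suc 0) (Poly_Mapping.single (f p) (Poly_Mapping.lookup x p))) \<subseteq> A"
    unfolding f path_boundary_1_single
    by (rule order_trans[OF keys_diff]) (use A in auto)
qed

section \<open>Adding a vertex to allowed and degenerate paths\<close>

lemma append_allowed_pathsI:
  assumes "p \<in> allowed_paths G n" "(last p, v) \<in> parcs G" "v \<in> pverts G"
  shows "p @ [v] \<in> allowed_paths G (Suc n)"
proof -
  have "last p = p ! n"
    using allowed_pathsD[OF assms(1)] by (simp add: last_conv_nth)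
  then show ?thesis using assms
    by (auto simp: allowed_paths_def sequences_def nth_append le_Suc_eq)
qed

lemma Cons_allowed_pathsI:
  assumes "p \<in> allowed_paths G n" "(v, hd p) \<in> parcs G" "v \<in> pverts G"
  shows "v # p \<in> allowed_paths G (Suc n)"
proof -
  have "((v # p) ! (i - 1), (v # p) ! i) \<in> parcs G" if "i \<in> {1..Suc n}" for i
  \<comment> \<open>Index 1 is the new arc from \<open>v\<close> to the first vertex of
    \<open>p\<close>; every other index is an arc of \<open>p\<close>, shifted by one.\<close>
  proof (cases "i = 1")
    case True
    then show ?thesis using assms allowed_pathsD(2)[OF assms(1)] by (simp add: hd_conv_nth)
  next
    case False
    with that have "i - 1 \<in> {1..n}" "i \<noteq> 0" "i - 1 \<noteq> 0" by auto
    moreover from this have "(p ! (i - 1 - 1), p ! (i - 1)) \<in> parcs G"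
      using assms(1) unfolding allowed_paths_def by blast
    ultimately show ?thesis by (simp add: nth_Cons')
  qed
  then show ?thesis using assms by (auto simp: allowed_paths_def sequences_def)
qed

text \<open>The repetition lies either inside \<open>q\<close> or at the seam, when \<open>q\<close>
  already ends in \<open>v\<close>. The second case is why boundary paths ending in \<open>v\<close>
  do no harm.\<close>

lemma append_degenerate_pathsI:
  assumes "v \<in> pverts G" "q \<in> degenerate_paths G n \<or> q \<in> sequences G n \<and> last q = v"
  shows "q @ [v] \<in> degenerate_paths G (Suc n)"
  using assms(2)
proof
  assume "q \<in> degenerate_paths G n"
  then show ?thesis using assms(1)
    by (force simp: degenerate_paths_def sequences_def nth_append)
next
  assume "q \<in> sequences G n \<and> last q = v"
  moreover from this have "q ! n = v" by (cases q rule: rev_cases) (auto simp: sequences_def)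
  ultimately show ?thesis using assms(1)
    by (auto simp: degenerate_paths_def sequences_def nth_append intro!: bexI[of _ "Suc n"])
qed

lemma Cons_degenerate_pathsI:
  assumes "v \<in> pverts G" "q \<in> degenerate_paths G n \<or> q \<in> sequences G n \<and> hd q = v"
  shows "v # q \<in> degenerate_paths G (Suc n)"
  using assms(2)
proof
  assume "q \<in> degenerate_paths G n"
  then obtain i where "i \<in> {1..n}" "q ! (i - 1) = q ! i" "q \<in> sequences G n"
    by (auto simp: degenerate_paths_def)
  then show ?thesis using assms(1)
    by (auto simp: degenerate_paths_def sequences_def intro!: bexI[of _ "Suc i"])
next
  assume "q \<in> sequences G n \<and> hd q = v"
  then show ?thesis using assms(1)
    by (cases q) (auto simp: degenerate_paths_def sequences_def intro!: bexI[of _ 1])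
qed

text \<open>In the boundary formula the term \<open>x\<close> up to sign is allowed. A path of the
  boundary of \<open>x\<close>, once extended, is degenerate if it was so before or if it ends in
  \<open>v\<close>, and allowed if its end has an arc to \<open>v\<close>. Assumption
  \<open>bd\<close> rules out the remaining possibility, and it is the part that the hypergraph has
  to supply.\<close>

lemma push_append_invariant:
  fixes x :: "('v, 'r::{comm_ring, monoid_mult}) chain"
  assumes v: "v \<in> pverts G" and x: "x \<in> invariant_chains G n"
    and heads: "\<And>p. p \<in> Poly_Mapping.keys x \<Longrightarrow> (last p, v) \<in> parcs G"
    and bd: "\<And>q. \<lbrakk>n \<noteq> 0; q \<in> allowed_paths G (n - 1); q \<in> Poly_Mapping.keys (path_boundary n x)\<rbrakk>
        \<Longrightarrow> last q = v \<or> (last q, v) \<in> parcs G"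
  shows "push_chain (\<lambda>p. p @ [v]) x \<in> invariant_chains G (n + 1)"
proof -
  let ?f = "\<lambda>p. p @ [v]"
  have kx: "Poly_Mapping.keys x \<subseteq> allowed_paths G n"
    and kb: "Poly_Mapping.keys (path_boundary n x) \<subseteq> allowed_paths G (n - 1) \<union> degenerate_paths G (n - 1)"
    using x by (auto simp: invariant_chains_iff)
  have "Poly_Mapping.keys (push_chain ?f x) \<subseteq> allowed_paths G (Suc n)"
    using keys_push_chain[of ?f x] kx heads v by (auto dest!: subsetD intro!: append_allowed_pathsI)
  moreover have "Poly_Mapping.keys (path_boundary (Suc n) (push_chain ?f x))
      \<subseteq> allowed_paths G n \<union> degenerate_paths G n"
  proof (cases "n = 0")
    case True
    have "Poly_Mapping.keys (path_boundary (Suc 0) (push_chain ?f x)) \<subseteq> allowed_paths G 0"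
    proof (rule keys_boundary_1)
      fix p assume "p \<in> Poly_Mapping.keys x"
      then have "p \<in> allowed_paths G 0" using kx True by auto
      then show "\<exists>a b. p @ [v] = [a, b] \<and> {[a], [b]} \<subseteq> allowed_paths G 0"
        using v by (auto simp: allowed_paths_def sequences_def length_Suc_conv)
    qed
    then show ?thesis using True by auto
  next
    case False
    have "?f ` Poly_Mapping.keys (path_boundary n x) \<subseteq> allowed_paths G n \<union> degenerate_paths G n"
    proof (rule image_subsetI)
      fix q assume q: "q \<in> Poly_Mapping.keys (path_boundary n x)"
      then show "q @ [v] \<in> allowed_paths G n \<union> degenerate_paths G n"
        using append_degenerate_pathsI[OF v, of q "n - 1"] bd[of q] kb v False
          append_allowed_pathsI[of q G "n - 1" v]
        by (auto simp: allowed_paths_def)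
    qed
    moreover have "Poly_Mapping.keys (\<Sum>p\<in>Poly_Mapping.keys x. Poly_Mapping.single p ((- 1) ^ Suc n * Poly_Mapping.lookup x p))
        \<subseteq> Poly_Mapping.keys x"
      by (rule order_trans[OF keys_sum]) auto
    moreover have "length p = Suc n" if "p \<in> Poly_Mapping.keys x" for p
      using that kx allowed_pathsD(1) by blast
    ultimately show ?thesis using kx keys_push_chain[of ?f "path_boundary n x"] False
      by (subst path_boundary_push_append) (auto dest!: subsetD[OF keys_add] subsetD)
  qed
  ultimately show ?thesis by (simp add: invariant_chains_iff)
qed

lemma push_Cons_invariant:
  fixes x :: "('v, 'r::{comm_ring, monoid_mult}) chain"
  assumes v: "v \<in> pverts G" and x: "x \<in> invariant_chains G n"
    and tails: "\<And>p. p \<in> Poly_Mapping.keys x \<Longrightarrow> (v, hd p) \<in> parcs G"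
    and bd: "\<And>q. \<lbrakk>n \<noteq> 0; q \<in> allowed_paths G (n - 1); q \<in> Poly_Mapping.keys (path_boundary n x)\<rbrakk>
        \<Longrightarrow> hd q = v \<or> (v, hd q) \<in> parcs G"
  shows "push_chain ((#) v) x \<in> invariant_chains G (n + 1)"
proof -
  let ?f = "(#) v"
  have kx: "Poly_Mapping.keys x \<subseteq> allowed_paths G n"
    and kb: "Poly_Mapping.keys (path_boundary n x) \<subseteq> allowed_paths G (n - 1) \<union> degenerate_paths G (n - 1)"
    using x by (auto simp: invariant_chains_iff)
  have "Poly_Mapping.keys (push_chain ?f x) \<subseteq> allowed_paths G (Suc n)"
    using keys_push_chain[of ?f x] kx tails v by (auto dest!: subsetD intro!: Cons_allowed_pathsI)
  moreover have "Poly_Mapping.keys (path_boundary (Suc n) (push_chain ?f x))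
      \<subseteq> allowed_paths G n \<union> degenerate_paths G n"
  proof (cases "n = 0")
    case True
    have "Poly_Mapping.keys (path_boundary (Suc 0) (push_chain ?f x)) \<subseteq> allowed_paths G 0"
    proof (rule keys_boundary_1)
      fix p assume "p \<in> Poly_Mapping.keys x"
      then have "p \<in> allowed_paths G 0" using kx True by auto
      then show "\<exists>a b. v # p = [a, b] \<and> {[a], [b]} \<subseteq> allowed_paths G 0"
        using v by (auto simp: allowed_paths_def sequences_def length_Suc_conv)
    qed
    then show ?thesis using True by auto
  next
    case False
    have "?f ` Poly_Mapping.keys (path_boundary n x) \<subseteq> allowed_paths G n \<union> degenerate_paths G n"
    proof (rule image_subsetI)
      fix q assume q: "q \<in> Poly_Mapping.keys (path_boundary n x)"
      then show "v # q \<in> allowed_paths G n \<union> degenerate_paths G n"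
        using Cons_degenerate_pathsI[OF v, of q "n - 1"] bd[of q] kb v False
          Cons_allowed_pathsI[of q G "n - 1" v]
        by (auto simp: allowed_paths_def)
    qed
    then show ?thesis using kx keys_push_chain[of ?f "path_boundary n x"] False
      by (subst path_boundary_push_Cons) (auto dest!: subsetD[OF keys_diff] subsetD)
  qed
  ultimately show ?thesis by (simp add: invariant_chains_iff)
qed

section \<open>Face maps\<close>

lemma head_face_at_add: "head_face_at n v (x + y) = head_face_at n v x + head_face_at n v y"
proof -
  \<comment> \<open>Moving the filter into the summand gives the shape that
    \<open>sum_keys_add\<close> handles.\<close>
  have "head_face_at n v x = (if n = 0 then 0 else \<Sum>p\<in>Poly_Mapping.keys x.
      if p ! (n - 1) = v then Poly_Mapping.single (butlast p) (Poly_Mapping.lookup x p) else 0)"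
    for x :: "('a, 'b) chain"
    by (auto simp: head_face_at_def sum.inter_filter)
  then show ?thesis by (auto intro!: sum_keys_add simp: single_add)
qed

lemma tail_face_at_add: "tail_face_at n v (x + y) = tail_face_at n v x + tail_face_at n v y"
proof -
  have "tail_face_at n v x = (if n = 0 then 0 else \<Sum>p\<in>Poly_Mapping.keys x.
      if p ! 1 = v then Poly_Mapping.single (tl p) (Poly_Mapping.lookup x p) else 0)"
    for x :: "('a, 'b) chain"
    by (auto simp: tail_face_at_def sum.inter_filter)
  then show ?thesis by (auto intro!: sum_keys_add simp: single_add)
qed

text \<open>Since \<open>p\<close> has \<open>n + 1\<close> vertices, index \<open>n - 1\<close> is
  its penultimate vertex, hence the last one of \<open>butlast p\<close>. In particular, faces at
  different vertices have disjoint supports.\<close>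

lemma keys_head_face_at:
  assumes "Poly_Mapping.keys x \<subseteq> allowed_paths G n" "q \<in> Poly_Mapping.keys (head_face_at n u x)"
  shows "last q = u"
proof -
  have n: "n \<noteq> 0" using assms(2) by (auto simp: head_face_at_def split: if_splits)
  with assms(2) have "q \<in> Poly_Mapping.keys (\<Sum>p | p \<in> Poly_Mapping.keys x \<and> p ! (n - 1) = u.
      Poly_Mapping.single (butlast p) (Poly_Mapping.lookup x p))" by (simp add: head_face_at_def)
  then obtain p where p: "p \<in> Poly_Mapping.keys x" "p ! (n - 1) = u" "q = butlast p"
    by (auto dest!: subsetD[OF keys_sum] split: if_splits)
  with assms(1) have "length p = Suc n" using allowed_pathsD(1) by blast
  moreover from this p n have "q \<noteq> []" by (cases p rule: rev_cases) auto
  ultimately show ?thesis using p n by (simp add: last_conv_nth nth_butlast)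
qed

lemma keys_tail_face_at:
  assumes "Poly_Mapping.keys x \<subseteq> allowed_paths G n" "q \<in> Poly_Mapping.keys (tail_face_at n u x)"
  shows "hd q = u"
proof -
  have n: "n \<noteq> 0" using assms(2) by (auto simp: tail_face_at_def split: if_splits)
  with assms(2) have "q \<in> Poly_Mapping.keys (\<Sum>p | p \<in> Poly_Mapping.keys x \<and> p ! 1 = u.
      Poly_Mapping.single (tl p) (Poly_Mapping.lookup x p))" by (simp add: tail_face_at_def)
  then obtain p where p: "p \<in> Poly_Mapping.keys x" "p ! 1 = u" "q = tl p"
    by (auto dest!: subsetD[OF keys_sum] split: if_splits)
  with assms(1) have "length p = Suc n" using allowed_pathsD(1) by blast
  moreover from this p n have "q \<noteq> []" by (cases p) auto
  ultimately show ?thesis using p n by (simp add: hd_conv_nth nth_tl)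
qed

text \<open>Only penultimate vertices of the finitely many paths in \<open>x\<close> can occur. Over
  an infinite vertex set this keeps the sum in \<open>head_face\<close> from defaulting to
  0.\<close>

lemma finite_nonzero_head_faces: "finite {u \<in> V. head_face_at n u x \<noteq> 0}"
proof (rule finite_subset)
  show "{u \<in> V. head_face_at n u x \<noteq> 0} \<subseteq> (\<lambda>p. p ! (n - 1)) ` Poly_Mapping.keys x"
    by (fastforce simp: head_face_at_def split: if_splits elim!: sum.not_neutral_contains_not_neutral)
qed simp

lemma finite_nonzero_tail_faces: "finite {u \<in> V. tail_face_at n u x \<noteq> 0}"
proof (rule finite_subset)
  show "{u \<in> V. tail_face_at n u x \<noteq> 0} \<subseteq> (\<lambda>p. p ! 1) ` Poly_Mapping.keys x"
    by (fastforce simp: tail_face_at_def split: if_splits elim!: sum.not_neutral_contains_not_neutral)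
qed simp

text \<open>Different \<open>d w\<close> cannot cancel, because \<open>g\<close> recovers
  \<open>w\<close> from any path of \<open>d w\<close>; so a path of \<open>d u\<close> keeps its
  coefficient in the sum. Completeness is phrased through the total face, and this lemma reaches it
  from a nonzero face at one vertex.\<close>

lemma mem_image_keys_sum:
  assumes "\<And>w q. q \<in> Poly_Mapping.keys (d w) \<Longrightarrow> g q = w"
    and "finite {w \<in> V. d w \<noteq> 0}" "u \<in> V" "d u \<noteq> 0"
  shows "u \<in> g ` Poly_Mapping.keys (\<Sum>w | w \<in> V \<and> d w \<noteq> 0. d w)"
proof -
  obtain q where q: "q \<in> Poly_Mapping.keys (d u)" using \<open>d u \<noteq> 0\<close> by fastforce
  define c where "c = Poly_Mapping.lookup (d u) q"
  have "Poly_Mapping.lookup (d w) q = (if w = u then c else 0)" for w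
    using assms(1)[of q w] assms(1)[OF q] by (auto simp: c_def in_keys_iff)
  then have "Poly_Mapping.lookup (\<Sum>w | w \<in> V \<and> d w \<noteq> 0. d w) q = c"
    using assms(2-4) by (simp add: lookup_sum)
  with q have "q \<in> Poly_Mapping.keys (\<Sum>w | w \<in> V \<and> d w \<noteq> 0. d w)" by (simp add: in_keys_iff c_def)
  with assms(1)[OF q] show ?thesis by blast
qed

section \<open>Coefficients of the boundary as coefficients of faces\<close>

lemma lookup_path_boundary:
  "n \<noteq> 0 \<Longrightarrow> Poly_Mapping.lookup (path_boundary n x) q =
     (\<Sum>p\<in>Poly_Mapping.keys x. \<Sum>i\<le>n. if face i p = q then (- 1) ^ i * Poly_Mapping.lookup x p else 0)"
  by (simp add: path_boundary_def lookup_sum lookup_single when_def)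

text \<open>Deleting a vertex other than the last keeps the end of \<open>p\<close>, which differs
  from the end of \<open>q\<close>. Only index \<open>n\<close> can therefore produce
  \<open>q\<close>, and this deletion is the one recorded by the head face.\<close>

lemma lookup_path_boundary_last:
  fixes x :: "('v, 'r::{comm_ring, monoid_mult}) chain"
  assumes kx: "Poly_Mapping.keys x \<subseteq> allowed_paths G n" and n: "n \<noteq> 0" and "length q = n"
    and ne: "\<And>p. p \<in> Poly_Mapping.keys x \<Longrightarrow> last p \<noteq> last q"
  shows "Poly_Mapping.lookup (path_boundary n x) q = (- 1) ^ n * Poly_Mapping.lookup (head_face_at n (last q) x) q"
proof -
  have q: "q \<noteq> []" using assms(3) n by auto
  have "(\<Sum>i\<le>n. if face i p = q then (- 1) ^ i * Poly_Mapping.lookup x p else 0) =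
      (- 1) ^ n * (if p ! (n - 1) = last q then if butlast p = q then Poly_Mapping.lookup x p else 0 else 0)"
    if p: "p \<in> Poly_Mapping.keys x" for p
  proof -
    have len: "length p = Suc n" using p kx allowed_pathsD(1) by blast
    have "face i p \<noteq> q" if "i < n" for i
    proof -
      have "last (face i p) = last p" using that len by simp
      with ne[OF p] show ?thesis by auto
    qed
    moreover have "face n p = butlast p" using len by (simp add: butlast_conv_take)
    \<comment> \<open>The filter in \<open>head_face_at\<close> thus excludes no path that
      contributes to \<open>q\<close>.\<close>
    moreover have "p ! (n - 1) = last q" if "butlast p = q"
      using that q n len last_conv_nth[OF q] assms(3) nth_butlast[of "n - 1" p] by simp
    ultimately show ?thesis
      by (subst sum.remove[of _ n]) (auto intro!: sum.neutral)
  qed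
  then show ?thesis using n
    by (simp add: lookup_path_boundary head_face_at_def lookup_sum lookup_single when_def
        sum.inter_filter sum_distrib_left if_distrib[of "\<lambda>c. Poly_Mapping.lookup c q"] cong: if_cong)
qed

text \<open>As for last vertices, with index 0 as the only one that changes the first vertex; its
  sign is 1.\<close>

lemma lookup_path_boundary_hd:
  fixes x :: "('v, 'r::{comm_ring, monoid_mult}) chain"
  assumes kx: "Poly_Mapping.keys x \<subseteq> allowed_paths G n" and n: "n \<noteq> 0" and "length q = n"
    and ne: "\<And>p. p \<in> Poly_Mapping.keys x \<Longrightarrow> hd p \<noteq> hd q"
  shows "Poly_Mapping.lookup (path_boundary n x) q = Poly_Mapping.lookup (tail_face_at n (hd q) x) q"
proof -
  have q: "q \<noteq> []" using assms(3) n by auto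
  have "(\<Sum>i\<le>n. if face i p = q then (- 1) ^ i * Poly_Mapping.lookup x p else 0) =
      (if p ! 1 = hd q then if tl p = q then Poly_Mapping.lookup x p else 0 else 0)"
    if p: "p \<in> Poly_Mapping.keys x" for p
  proof -
    have len: "length p = Suc n" using p kx allowed_pathsD(1) by blast
    have "face i p \<noteq> q" if "i \<noteq> 0" for i
    proof -
      have "hd (face i p) = hd p" using that len by (cases p; cases i) auto
      with ne[OF p] show ?thesis by auto
    qed
    moreover have "face 0 p = tl p" by (simp add: drop_Suc)
    moreover have "p ! 1 = hd q" if "tl p = q"
      using that q n len hd_conv_nth[OF q] nth_tl[of 0 p] by simp
    ultimately show ?thesis
      by (subst sum.remove[of _ 0]) (auto intro!: sum.neutral)
  qed
  then show ?thesis using n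
    by (simp add: lookup_path_boundary tail_face_at_def lookup_sum lookup_single when_def
        sum.inter_filter if_distrib[of "\<lambda>c. Poly_Mapping.lookup c q"] cong: if_cong)
qed

section \<open>Cancellation of faces along hyperedges\<close>

lemma finite_term_symbols: "finite (term_symbols d xs F u)"
proof (rule finite_subset)
  show "term_symbols d xs F u \<subseteq> (SIGMA i:{..<length xs}. {..<length (face_terms F i u)})"
    by (auto simp: term_symbols_def)
qed simp

text \<open>For two opposite terms, \<open>i \<noteq> j\<close> makes the symbols distinct, so both
  terms are counted and cancel; in the other alternative the zero sum is part of the
  definition.\<close>

lemma admissible_label_sum_zero:
  assumes "admissible_label G d xs F S u"
  shows "(\<Sum>(i, k)\<in>S. face_terms F i u ! k) = 0"
  using assms by (auto simp: admissible_label_def)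

text \<open>The face map \<open>d\<close> is kept abstract and additive so that heads and tails
  share the argument: expand the face into all chosen terms at \<open>u\<close>, then regroup them
  by hyperedge.\<close>

lemma face_sum_zero:
  assumes F: "face_multihypergraph G n d xs F" and u: "u \<in> pverts G"
    and add: "\<And>x y. d u (x + y) = d u x + d u y"
    and complete: "\<And>i k. (i, k) \<in> term_symbols d xs F u \<Longrightarrow> \<exists>S. (S, u) \<in> hyperedges F \<and> (i, k) \<in> S"
  shows "d u (sum_list xs) = 0"
proof -
  let ?T = "term_symbols d xs F u" and ?t = "\<lambda>(i, k). face_terms F i u ! k"
  let ?H = "{S. (S, u) \<in> hyperedges F}"
  have "d u 0 = 0" using add[of 0 0] by simp
  then have "d u (sum_list ys) = (\<Sum>i<length ys. d u (ys ! i))" for ys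
    by (induction ys) (auto simp: add sum.lessThan_Suc_shift simp del: sum.lessThan_Suc)
  then have "d u (sum_list xs) = (\<Sum>i<length xs. d u (xs ! i))" .
  \<comment> \<open>A vanishing face has no prescribed decomposition; the condition
    \<open>d u (xs ! i) \<noteq> 0\<close> makes its inner sum empty.\<close>
  also have "\<dots> = (\<Sum>i<length xs. \<Sum>k | d u (xs ! i) \<noteq> 0 \<and> k < length (face_terms F i u). ?t (i, k))"
  proof (rule sum.cong)
    fix i assume "i \<in> {..<length xs}"
    then show "d u (xs ! i) = (\<Sum>k | d u (xs ! i) \<noteq> 0 \<and> k < length (face_terms F i u). ?t (i, k))"
      using F u by (cases "d u (xs ! i) = 0")
        (auto simp: face_multihypergraph_def face_decomposition_def sum_list_sum_nth
          atLeast0LessThan lessThan_def)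
  qed simp
  also have "\<dots> = sum ?t ?T"
    by (subst sum.Sigma) (auto simp: term_symbols_def intro!: sum.cong)
  \<comment> \<open>Completeness gives one inclusion, admissibility of the labels the other.\<close>
  also have "?T = \<Union> ?H"
    using F complete by (fastforce simp: face_multihypergraph_def admissible_label_def)
  also have "sum ?t (\<Union> ?H) = (\<Sum>S\<in>?H. sum ?t S)"
  proof (rule sum.Union_disjoint[THEN trans])
    show "\<forall>S\<in>?H. finite S"
      using F finite_subset[OF _ finite_term_symbols]
      by (fastforce simp: face_multihypergraph_def admissible_label_def)
    show "\<forall>S\<in>?H. \<forall>T\<in>?H. S \<noteq> T \<longrightarrow> S \<inter> T = {}"
      using F unfolding face_multihypergraph_def by blast
  qed simp
  also have "\<dots> = 0"
  proof (rule sum.neutral, rule ballI)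
    fix S assume "S \<in> ?H"
    then have "admissible_label G d xs F S u"
      using F unfolding face_multihypergraph_def by blast
    then show "sum ?t S = 0" by (rule admissible_label_sum_zero)
  qed
  finally show ?thesis .
qed

section \<open>Complete extensions are invariant\<close>

theorem proposition4p1:
  fixes G :: "'v pair_pre_digraph" and n :: nat and v :: 'v
    and xs :: "('v, 'r::{comm_ring, monoid_mult}) chain list"
  assumes "pair_loopfree_digraph G"
    and "v \<in> pverts G"
    and "set xs \<subseteq> invariant_chains G n"
  shows "(\<forall>F. upper_face_multihypergraph G n xs F \<and> is_upper_extension_over G v xs \<and>
              upper_complete G n v xs F \<longrightarrow>
              upper_extension G n v (sum_list xs) \<in> invariant_chains G (n + 1)) \<and>
         (\<forall>F. lower_face_multihypergraph G n xs F \<and> is_lower_extension_over G v xs \<and>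
              lower_complete G n v xs F \<longrightarrow>
              lower_extension G n v (sum_list xs) \<in> invariant_chains G (n + 1))"
proof (intro conjI allI impI; elim conjE)
  let ?x = "sum_list xs"
  have x: "?x \<in> invariant_chains G n" using assms(3) by (rule invariant_chains_sum_list)
  then have kx: "Poly_Mapping.keys ?x \<subseteq> allowed_paths G n" by (simp add: invariant_chains_iff)
  have kxi: "Poly_Mapping.keys (xs ! i) \<subseteq> allowed_paths G n" if "i < length xs" for i
    using subsetD[OF assms(3) nth_mem[OF that]] by (simp add: invariant_chains_iff)
  {
    fix F
    assume F: "upper_face_multihypergraph G n xs F" and ext: "is_upper_extension_over G v xs"
      and compl: "upper_complete G n v xs F"
    \<comment> \<open>The condition is imposed on each summand; it passes to the sum because every
      path of the sum occurs in some summand.\<close>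
    have heads: "(last p, v) \<in> parcs G" if "p \<in> Poly_Mapping.keys ?x" for p
      using that ext keys_sum_list[of xs] by (fastforce simp: is_upper_extension_over_def head_set_def)
    \<comment> \<open>By \<open>heads\<close> every extended path is allowed, so the filter in the
      extension discards nothing.\<close>
    have "upper_extension G n v ?x = push_chain (\<lambda>p. p @ [v]) ?x"
      unfolding upper_extension_def push_chain_def
      using kx heads assms(2) by (intro sum.cong) (auto intro: append_allowed_pathsI)
    also have "\<dots> \<in> invariant_chains G (n + 1)"
      using assms(2) x heads
    proof (rule push_append_invariant)
      fix q assume n: "n \<noteq> 0" and q: "q \<in> allowed_paths G (n - 1)"
        and b: "q \<in> Poly_Mapping.keys (path_boundary n ?x)"
      show "last q = v \<or> (last q, v) \<in> parcs G"
      proof (rule ccontr)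
        assume c: "\<not> (last q = v \<or> (last q, v) \<in> parcs G)"
        have u: "last q \<in> pverts G" using allowed_pathsD[OF q] last_in_set by blast
        have "head_face_at n (last q) ?x = 0"
          using F[unfolded upper_face_multihypergraph_def] u head_face_at_add
        proof (rule face_sum_zero)
          fix i k assume "(i, k) \<in> term_symbols (head_face_at n) xs F (last q)"
          then have i: "i < length xs" "head_face_at n (last q) (xs ! i) \<noteq> 0"
              "k < length (face_terms F i (last q))"
            by (auto simp: term_symbols_def)
          \<comment> \<open>The nonzero face of the summand at \<open>last q\<close> survives in its
            total face, so with \<open>c\<close> completeness applies at this vertex.\<close>
          have "last q \<in> head_set (head_face G n (xs ! i))"
            unfolding head_set_def head_face_def
            using keys_head_face_at[OF kxi[OF i(1)]] finite_nonzero_head_faces u i(2)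
            by (rule mem_image_keys_sum)
          then show "\<exists>S. (S, last q) \<in> hyperedges F \<and> (i, k) \<in> S"
            using compl i c by (auto simp: upper_complete_def)
        qed
        \<comment> \<open>Ends of paths of the sum have an arc to \<open>v\<close>, and
          \<open>last q\<close> has none. Hence the coefficient of \<open>q\<close> in the boundary
          is, up to sign, one of the vanishing face.\<close>
        moreover have "last p \<noteq> last q" if "p \<in> Poly_Mapping.keys ?x" for p
          using heads[OF that] c by auto
        moreover have "length q = n" using allowed_pathsD(1)[OF q] n by simp
        ultimately show False
          using lookup_path_boundary_last[OF kx n] b by (simp add: in_keys_iff)
      qed
    qed
    finally show "upper_extension G n v ?x \<in> invariant_chains G (n + 1)" .
  }
  \<comment> \<open>The mirror argument, with first vertices, arcs out of \<open>v\<close> and tail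
    faces.\<close>
  {
    fix F
    assume F: "lower_face_multihypergraph G n xs F" and ext: "is_lower_extension_over G v xs"
      and compl: "lower_complete G n v xs F"
    have tails: "(v, hd p) \<in> parcs G" if "p \<in> Poly_Mapping.keys ?x" for p
      using that ext keys_sum_list[of xs] by (fastforce simp: is_lower_extension_over_def tail_set_def)
    have "lower_extension G n v ?x = push_chain ((#) v) ?x"
      unfolding lower_extension_def push_chain_def
      using kx tails assms(2) by (intro sum.cong) (auto intro: Cons_allowed_pathsI)
    also have "\<dots> \<in> invariant_chains G (n + 1)"
      using assms(2) x tails
    proof (rule push_Cons_invariant)
      fix q assume n: "n \<noteq> 0" and q: "q \<in> allowed_paths G (n - 1)"
        and b: "q \<in> Poly_Mapping.keys (path_boundary n ?x)"
      show "hd q = v \<or> (v, hd q) \<in> parcs G"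
      proof (rule ccontr)
        assume c: "\<not> (hd q = v \<or> (v, hd q) \<in> parcs G)"
        have u: "hd q \<in> pverts G" using allowed_pathsD[OF q] hd_in_set by blast
        have "tail_face_at n (hd q) ?x = 0"
          using F[unfolded lower_face_multihypergraph_def] u tail_face_at_add
        proof (rule face_sum_zero)
          fix i k assume "(i, k) \<in> term_symbols (tail_face_at n) xs F (hd q)"
          then have i: "i < length xs" "tail_face_at n (hd q) (xs ! i) \<noteq> 0"
              "k < length (face_terms F i (hd q))"
            by (auto simp: term_symbols_def)
          have "hd q \<in> tail_set (tail_face G n (xs ! i))"
            unfolding tail_set_def tail_face_def
            using keys_tail_face_at[OF kxi[OF i(1)]] finite_nonzero_tail_faces u i(2)
            by (rule mem_image_keys_sum)
          then show "\<exists>S. (S, hd q) \<in> hyperedges F \<and> (i, k) \<in> S"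
            using compl i c by (auto simp: lower_complete_def)
        qed
        moreover have "hd p \<noteq> hd q" if "p \<in> Poly_Mapping.keys ?x" for p
          using tails[OF that] c by auto
        moreover have "length q = n" using allowed_pathsD(1)[OF q] n by simp
        ultimately show False
          using lookup_path_boundary_hd[OF kx n] b by (simp add: in_keys_iff)
      qed
    qed
    finally show "lower_extension G n v ?x \<in> invariant_chains G (n + 1)" .
  }
qed

end
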